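(* Let $0<\kappa<1$ and let $m_\kappa$ be the largest positive integer such that $m_\kappa\kappa<1$. Then the equation $$\kappa^2u''+u-u^3=0\quad\text{in }\mathbb{R}$$ admits exactly $m_\kappa$ non-constant $2\pi$-periodic solutions up to translation and odd reflection.
   Context: A $2\pi$-periodic solution means a (classical, real-valued) solution $u:\mathbb{R}\to\mathbb{R}$ with $u(x+2\pi)=u(x)$ for all $x\in\mathbb R$; $2\pi$ need not be the minimal period. "Up to translation and odd reflection" means that solutions are identified when one is obtained from the other by the operations $u(x)\mapsto u(x+a)$, $a\in\mathbb{R}$, and $u(x)\mapsto u(-x)$ (for an odd function the latter is $u\mapsto -u$). *)

theory Defs
  imports "HOL-Analysis.Analysis"
begin

definition classical_solution :: "real \<Rightarrow> (real \<Rightarrow> real) \<Rightarrow> bool" where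
  "classical_solution \<kappa> u \<longleftrightarrow>
     (\<forall>x. u differentiable (at x)) \<and>
     (\<forall>x. deriv u differentiable (at x)) \<and>
     continuous_on UNIV (deriv (deriv u)) \<and>
     (\<forall>x. \<kappa>\<^sup>2 * deriv (deriv u) x + u x - u x ^ 3 = 0)"

text \<open>The number \<open>2 * pi\<close> is a period, not necessarily the minimal one.\<close>

definition nonconstant_periodic_solutions :: "real \<Rightarrow> (real \<Rightarrow> real) set" where
  "nonconstant_periodic_solutions \<kappa> =
     {u. classical_solution \<kappa> u \<and> (\<forall>x. u (x + 2 * pi) = u x) \<and> \<not> u constant_on UNIV}"

inductive obtained_from :: "(real \<Rightarrow> real) \<Rightarrow> (real \<Rightarrow> real) \<Rightarrow> bool" for u where
  same: "obtained_from u u"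
| translate: "obtained_from u v \<Longrightarrow> obtained_from u (\<lambda>x. v (x + a))"
| reflect: "obtained_from u v \<Longrightarrow> obtained_from u (\<lambda>x. v (- x))"

definition identified :: "real \<Rightarrow> ((real \<Rightarrow> real) \<times> (real \<Rightarrow> real)) set" where
  "identified \<kappa> =
     {(u, v). u \<in> nonconstant_periodic_solutions \<kappa> \<and>
              v \<in> nonconstant_periodic_solutions \<kappa> \<and> obtained_from u v}"

definition m_kappa :: "real \<Rightarrow> nat" where
  "m_kappa \<kappa> = (GREATEST m. 0 < m \<and> real m * \<kappa> < 1)"

lemma obtained_from_trans:
  assumes "obtained_from u v" "obtained_from v w"
  shows "obtained_from u w"
  using assms(2,1) by induction (auto intro: obtained_from.intros)

lemma obtained_from_sym:
  assumes "obtained_from u v"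
  shows "obtained_from v u"
  using assms
proof induction
  case same
  show ?case by (rule obtained_from.same)
next
  case (translate v a)
  have "obtained_from (\<lambda>x. v (x + a)) (\<lambda>x. v ((x + - a) + a))"
    by (rule obtained_from.translate[OF obtained_from.same])
  then have "obtained_from (\<lambda>x. v (x + a)) v" by simp
  then show ?case using translate.IH by (rule obtained_from_trans)
next
  case (reflect v)
  have "obtained_from (\<lambda>x. v (- x)) (\<lambda>x. v (- (- x)))"
    by (rule obtained_from.reflect[OF obtained_from.same])
  then have "obtained_from (\<lambda>x. v (- x)) v" by simp
  then show ?case using reflect.IH by (rule obtained_from_trans)
qed

lemma equiv_identified: "equiv (nonconstant_periodic_solutions \<kappa>) (identified \<kappa>)"
  unfolding equiv_def refl_on_def sym_def trans_def identified_def
  by (auto intro: obtained_from.same obtained_from_sym obtained_from_trans)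

lemma m_kappa_largest:
  assumes "0 < \<kappa>" "\<kappa> < 1"
  shows "0 < m_kappa \<kappa>" "real (m_kappa \<kappa>) * \<kappa> < 1"
    and "\<And>m. 0 < m \<Longrightarrow> real m * \<kappa> < 1 \<Longrightarrow> m \<le> m_kappa \<kappa>"
proof -
  let ?P = "\<lambda>m::nat. 0 < m \<and> real m * \<kappa> < 1"
  have bound: "m \<le> nat \<lceil>1 / \<kappa>\<rceil>" if "?P m" for m
  proof -
    have "real m < 1 / \<kappa>" using that assms(1) by (simp add: field_simps)
    then show ?thesis by linarith
  qed
  have "?P 1" using assms(2) by simp
  then have P: "?P (m_kappa \<kappa>)"
    unfolding m_kappa_def using bound by (rule GreatestI_nat)
  show "0 < m_kappa \<kappa>" "real (m_kappa \<kappa>) * \<kappa> < 1" using P by simp_all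
  show "m \<le> m_kappa \<kappa>" if "0 < m" "real m * \<kappa> < 1" for m
    unfolding m_kappa_def by (rule Greatest_le_nat[where P = ?P, OF conjI[OF that] bound])
qed

end

theory Submission
  imports Defs
begin

text \<open>The substitution \<open>u x = a * sin (\<theta> (x / \<kappa>))\<close> turns the solution that starts at
  rest from its maximum \<open>a\<close>, where \<open>0 < a < 1\<close>, into the first-order equation
  \<open>\<theta>' = sqrt (1 - a\<^sup>2 * (1 + (sin \<theta>)\<^sup>2) / 2)\<close>; this is conservation of the energy
  \<open>\<kappa>\<^sup>2 * u'\<^sup>2 / 2 + u\<^sup>2 / 2 - u ^ 4 / 4\<close>. The right-hand side is positive, so the angle
  turns forever, and in the time scale \<open>x / \<kappa>\<close> a full turn takes \<open>period a\<close>, the integral of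
  the inverse speed over \<open>{0..2 * pi}\<close>. Hence this solution is \<open>2 * pi\<close>-periodic exactly when
  \<open>k * period a = 2 * pi / \<kappa>\<close> for some \<open>k \<ge> 1\<close> (\<open>profile_exists\<close>).

  There are no other non-constant periodic solutions: the second derivative test at the maximum and
  at the minimum forces the maximum into the interval from 0 to 1
  (\<open>nonconstant_periodic_solution_max\<close>), and by uniqueness for the initial value problem
  (\<open>bounded_solution_unique\<close>) the solution is then a translate of the one above with the same
  maximum. Translations and reflections preserve the maximum, so a class is determined by its
  amplitude \<open>a\<close>.

  It remains to count amplitudes. The function \<open>period\<close> increases strictly and continuously from
  \<open>2 * pi\<close> at \<open>a = 0\<close> to infinity as \<open>a\<close> tends to 1. So for each \<open>k\<close> the equation
  \<open>k * period a = 2 * pi / \<kappa>\<close> has a solution, necessarily unique, exactly when \<open>k * \<kappa> < 1\<close>,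
  that is, when \<open>k \<le> m_kappa \<kappa>\<close>.\<close>

section \<open>The equation as a first-order system\<close>

definition solves :: "real \<Rightarrow> (real \<Rightarrow> real) \<Rightarrow> (real \<Rightarrow> real) \<Rightarrow> bool" where
  "solves \<kappa> u v \<longleftrightarrow>
     (\<forall>x. (u has_real_derivative v x) (at x)) \<and>
     (\<forall>x. (v has_real_derivative (u x ^ 3 - u x) / \<kappa>\<^sup>2) (at x))"

text \<open>The second derivative equals \<open>(u ^ 3 - u) / \<kappa>\<^sup>2\<close>, so its continuity is automatic.\<close>

lemma classical_solution_iff:
  assumes "0 < \<kappa>"
  shows "classical_solution \<kappa> u \<longleftrightarrow> (\<exists>v. solves \<kappa> u v)"
proof
  assume u: "classical_solution \<kappa> u"
  have "(u has_real_derivative deriv u x) (at x)" for x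
    using u by (simp add: classical_solution_def DERIV_deriv_iff_real_differentiable)
  moreover have "(deriv u has_real_derivative (u x ^ 3 - u x) / \<kappa>\<^sup>2) (at x)" for x
  proof -
    have "(deriv u has_real_derivative deriv (deriv u) x) (at x)"
      using u by (simp add: classical_solution_def DERIV_deriv_iff_real_differentiable)
    moreover have "\<kappa>\<^sup>2 * deriv (deriv u) x + u x - u x ^ 3 = 0"
      using u by (simp add: classical_solution_def)
    then have "deriv (deriv u) x = (u x ^ 3 - u x) / \<kappa>\<^sup>2"
      using assms by (simp add: field_simps)
    ultimately show ?thesis by simp
  qed
  ultimately show "\<exists>v. solves \<kappa> u v" unfolding solves_def by blast
next
  assume "\<exists>v. solves \<kappa> u v"
  then obtain v where
    u': "\<And>x. (u has_real_derivative v x) (at x)" and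
    v': "\<And>x. (v has_real_derivative (u x ^ 3 - u x) / \<kappa>\<^sup>2) (at x)"
    unfolding solves_def by blast
  have du: "deriv u = v" using u' by (intro ext DERIV_imp_deriv)
  have dv: "deriv v = (\<lambda>x. (u x ^ 3 - u x) / \<kappa>\<^sup>2)" using v' by (intro ext DERIV_imp_deriv)
  have "continuous_on UNIV u"
    by (rule has_real_derivative_imp_continuous_on[OF u'])
  then have "continuous_on UNIV (\<lambda>x. (u x ^ 3 - u x) / \<kappa>\<^sup>2)"
    using assms by (intro continuous_intros) auto
  then show "classical_solution \<kappa> u"
    using u' v' assms unfolding classical_solution_def du dv
    by (auto simp: real_differentiable_def field_simps)
qed

lemma solves_shift:
  assumes "solves \<kappa> u v"
  shows "solves \<kappa> (\<lambda>x. u (x + c)) (\<lambda>x. v (x + c))"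
  using assms unfolding solves_def
  by (simp add: DERIV_shift[symmetric])

text \<open>Gronwall's argument, forwards and backwards in time: \<open>E\<close> grows at most like
  \<open>exp (C * x)\<close> and decays at most like \<open>exp (- C * x)\<close>.\<close>

lemma zero_if_derivative_le_multiple:
  fixes E E' :: "real \<Rightarrow> real"
  assumes der: "\<And>x. (E has_real_derivative E' x) (at x)"
    and nonneg: "\<And>x. 0 \<le> E x"
    and bound: "\<And>x. \<bar>E' x\<bar> \<le> C * E x"
    and start: "E x0 = 0"
  shows "E x = 0"
proof (cases "x0 \<le> x")
  case True
  have "- (E x0 * exp (- C * x0)) \<le> - (E x * exp (- C * x))"
  proof (rule DERIV_nonneg_imp_nondecreasing[OF True])
    fix t
    have "((\<lambda>t. - (E t * exp (- C * t))) has_real_derivative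
        (C * E t - E' t) * exp (- C * t)) (at t)"
      by (auto intro!: derivative_eq_intros der simp: algebra_simps)
    moreover have "0 \<le> (C * E t - E' t) * exp (- C * t)"
      using bound[of t] by (intro mult_nonneg_nonneg) auto
    ultimately show "\<exists>y. ((\<lambda>t. - (E t * exp (- C * t))) has_real_derivative y) (at t) \<and> 0 \<le> y"
      by blast
  qed
  then have "E x \<le> 0" using start by (simp add: mult_le_0_iff)
  then show ?thesis using nonneg[of x] by simp
next
  case False
  then have le: "x \<le> x0" by simp
  have "E x * exp (C * x) \<le> E x0 * exp (C * x0)"
  proof (rule DERIV_nonneg_imp_nondecreasing[OF le])
    fix t
    have "((\<lambda>t. E t * exp (C * t)) has_real_derivative
        (C * E t + E' t) * exp (C * t)) (at t)"
      by (auto intro!: derivative_eq_intros der simp: algebra_simps)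
    moreover have "0 \<le> (C * E t + E' t) * exp (C * t)"
      using bound[of t] by (intro mult_nonneg_nonneg) auto
    ultimately show "\<exists>y. ((\<lambda>t. E t * exp (C * t)) has_real_derivative y) (at t) \<and> 0 \<le> y"
      by blast
  qed
  then have "E x \<le> 0" using start by (simp add: mult_le_0_iff)
  then show ?thesis using nonneg[of x] by simp
qed

text \<open>The difference \<open>w\<close> of two solutions satisfies a linear equation
  \<open>w'' = q * w\<close>, and \<open>q\<close> is bounded because the solutions are; so the squared distance
  in the phase plane satisfies the hypothesis of the previous lemma.\<close>

lemma bounded_solution_unique:
  assumes sol: "solves \<kappa> u1 v1" "solves \<kappa> u2 v2"
    and bd: "\<And>x. \<bar>u1 x\<bar> \<le> B" "\<And>x. \<bar>u2 x\<bar> \<le> B"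
    and start: "u1 x0 = u2 x0" "v1 x0 = v2 x0"
  shows "u1 = u2"
proof
  fix x
  define q where "q t = (u1 t ^ 2 + u1 t * u2 t + u2 t ^ 2 - 1) / \<kappa>\<^sup>2" for t
  define E where "E t = (u1 t - u2 t)\<^sup>2 + (v1 t - v2 t)\<^sup>2" for t
  define E' where "E' t = 2 * ((u1 t - u2 t) * (v1 t - v2 t)) * (1 + q t)" for t
  define C where "C = 1 + (3 * B\<^sup>2 + 1) / \<kappa>\<^sup>2"
  have "(E has_real_derivative E' t) (at t)" for t
  proof -
    have diff: "(u1 t ^ 3 - u1 t) / \<kappa>\<^sup>2 - (u2 t ^ 3 - u2 t) / \<kappa>\<^sup>2 = q t * (u1 t - u2 t)"
      unfolding q_def diff_divide_distrib[symmetric] times_divide_eq_left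
      by (rule arg_cong[where f = "\<lambda>y. y / \<kappa>\<^sup>2"]) (simp add: algebra_simps power2_eq_square power3_eq_cube)
    have "(E has_real_derivative
        2 * (u1 t - u2 t) * (v1 t - v2 t)
        + 2 * (v1 t - v2 t) * ((u1 t ^ 3 - u1 t) / \<kappa>\<^sup>2 - (u2 t ^ 3 - u2 t) / \<kappa>\<^sup>2)) (at t)"
      unfolding E_def using sol unfolding solves_def
      by (auto intro!: derivative_eq_intros simp: algebra_simps)
    then show ?thesis
      unfolding diff by (rule DERIV_cong) (simp add: E'_def algebra_simps)
  qed
  moreover have "0 \<le> E t" for t unfolding E_def by simp
  moreover have "\<bar>E' t\<bar> \<le> C * E t" for t
  proof -
    have "\<bar>u1 t\<bar>\<^sup>2 \<le> B\<^sup>2" "\<bar>u2 t\<bar>\<^sup>2 \<le> B\<^sup>2"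
      using bd[of t] by (intro power_mono; simp)+
    moreover have "\<bar>u1 t\<bar> * \<bar>u2 t\<bar> \<le> B * B"
      using bd[of t] by (intro mult_mono) auto
    ultimately have "\<bar>u1 t ^ 2 + u1 t * u2 t + u2 t ^ 2 - 1\<bar> \<le> 3 * B\<^sup>2 + 1"
      unfolding abs_mult[symmetric] power2_eq_square
      using zero_le_square[of "u1 t"] zero_le_square[of "u2 t"] zero_le_square[of B] by linarith
    then have "\<bar>q t\<bar> \<le> (3 * B\<^sup>2 + 1) / \<kappa>\<^sup>2"
      unfolding q_def by (simp add: divide_right_mono)
    then have "\<bar>1 + q t\<bar> \<le> C" unfolding C_def by linarith
    moreover have "\<bar>2 * ((u1 t - u2 t) * (v1 t - v2 t))\<bar> \<le> E t"
      using sum_squares_bound[of "\<bar>u1 t - u2 t\<bar>" "\<bar>v1 t - v2 t\<bar>"]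
      unfolding E_def by (simp add: abs_mult)
    ultimately show ?thesis
      unfolding E'_def abs_mult[of _ "1 + q t"] by (subst mult.commute) (intro mult_mono, auto)
  qed
  moreover have "E x0 = 0" using start unfolding E_def by simp
  ultimately have "E x = 0" by (rule zero_if_derivative_le_multiple)
  then show "u1 x = u2 x" unfolding E_def by (simp add: sum_power2_eq_zero_iff)
qed

section \<open>Periodic solutions oscillate around zero with amplitude below one\<close>

text \<open>If \<open>d\<close> were positive, then \<open>v\<close> would be positive just to the right of \<open>x0\<close>, and \<open>u\<close>
  would rise above its maximum there.\<close>

lemma second_derivative_at_max:
  fixes u v :: "real \<Rightarrow> real"
  assumes u': "\<And>x. (u has_real_derivative v x) (at x)"
    and v': "(v has_real_derivative d) (at x0)"
    and max: "\<And>x. u x \<le> u x0"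
  shows "v x0 = 0" "d \<le> 0"
proof -
  show v0: "v x0 = 0" using DERIV_local_max[OF u', of 1 x0] max by simp
  show "d \<le> 0"
  proof (rule ccontr)
    assume "\<not> d \<le> 0"
    then obtain e where e: "0 < e" "\<And>h. 0 < h \<Longrightarrow> h < e \<Longrightarrow> v x0 < v (x0 + h)"
      using DERIV_pos_inc_right[OF v'] by auto
    have "u x0 < u (x0 + e / 2)"
    proof (rule DERIV_pos_imp_increasing_open[where f = u])
      show "x0 < x0 + e / 2" using e(1) by simp
      show "\<exists>y. (u has_real_derivative y) (at x) \<and> 0 < y" if "x0 < x" "x < x0 + e / 2" for x
        using u'[of x] e(2)[of "x - x0"] e(1) that v0 by auto
      show "continuous_on {x0..x0 + e / 2} u"
        by (rule has_real_derivative_imp_continuous_on[OF u'])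
    qed
    then show False using max[of "x0 + e / 2"] by simp
  qed
qed

lemma periodic_shift_int:
  fixes f :: "real \<Rightarrow> 'a"
  assumes "\<And>x. f (x + L) = f x"
  shows "f (x + of_int k * L) = f x"
proof -
  have nat: "f (x + real n * L) = f x" for x n
  proof (induction n)
    case (Suc n)
    have "x + real (Suc n) * L = (x + real n * L) + L" by (simp add: algebra_simps)
    then show ?case using assms Suc by metis
  qed simp
  show ?thesis
  proof (cases "0 \<le> k")
    case True
    then show ?thesis using nat[of x "nat k"] by simp
  next
    case False
    then show ?thesis using nat[of "x + of_int k * L" "nat (- k)"] by (simp add: algebra_simps)
  qed
qed

lemma periodic_attains_max:
  fixes f :: "real \<Rightarrow> real"
  assumes per: "\<And>x. f (x + L) = f x" and L: "0 < L" and cont: "continuous_on UNIV f"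
  shows "\<exists>x0. \<forall>x. f x \<le> f x0"
proof -
  have "\<exists>x0\<in>{0..L}. \<forall>y\<in>{0..L}. f y \<le> f x0"
    using L by (intro continuous_attains_sup continuous_on_subset[OF cont]) auto
  then obtain x0 where x0: "\<And>y. y \<in> {0..L} \<Longrightarrow> f y \<le> f x0" by blast
  have "f x \<le> f x0" for x
  proof -
    define y where "y = x + of_int (- \<lfloor>x / L\<rfloor>) * L"
    have "0 \<le> y" "y \<le> L"
      unfolding y_def using floor_divide_lower[OF L, of x] floor_divide_upper[OF L, of x] by (auto simp: algebra_simps)
    then have "f y \<le> f x0" using x0 by simp
    then show ?thesis unfolding y_def periodic_shift_int[of f, OF per] .
  qed
  then show ?thesis by blast
qed

text \<open>At a maximum \<open>M\<close> and a minimum \<open>m\<close> the second derivative test gives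
  \<open>M - M ^ 3 \<ge> 0\<close> and \<open>m - m ^ 3 \<le> 0\<close>. If \<open>M - M ^ 3\<close> vanished, then \<open>u\<close> would be an
  equilibrium by uniqueness. So either \<open>0 < M < 1\<close> or \<open>M < -1\<close>, and in the latter case
  \<open>m \<le> M\<close> would violate the second inequality. The bound \<open>B\<close> is what the uniqueness lemma needs
  in order to compare \<open>u\<close> with an explicit solution.\<close>

lemma nonconstant_periodic_solution_max:
  assumes sol: "solves \<kappa> u v" and \<kappa>: "0 < \<kappa>"
    and per: "\<And>x. u (x + L) = u x" and L: "0 < L" and nonconst: "\<not> u constant_on UNIV"
  obtains x0 B where "0 < u x0" "u x0 < 1" "v x0 = 0" "\<And>x. \<bar>u x\<bar> \<le> B"
proof -
  have u': "(u has_real_derivative v x) (at x)"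
    and v': "(v has_real_derivative (u x ^ 3 - u x) / \<kappa>\<^sup>2) (at x)" for x
    using sol unfolding solves_def by auto
  have cont: "continuous_on UNIV u" by (rule has_real_derivative_imp_continuous_on[OF u'])
  obtain x0 where x0: "\<And>x. u x \<le> u x0"
    using periodic_attains_max[of u, OF per L cont] by blast
  have "\<exists>x1. \<forall>x. - u x \<le> - u x1"
    by (rule periodic_attains_max[OF _ L continuous_on_minus[OF cont]]) (simp add: per)
  then obtain x1 where x1: "\<And>x. - u x \<le> - u x1" by blast
  have bd: "\<bar>u x\<bar> \<le> \<bar>u x0\<bar> + \<bar>u x1\<bar>" for x using x0[of x] x1[of x] by linarith
  have v0: "v x0 = 0" and "(u x0 ^ 3 - u x0) / \<kappa>\<^sup>2 \<le> 0"
    using second_derivative_at_max[of u v, OF u' v' x0] by auto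
  then have d0: "u x0 ^ 3 \<le> u x0" using \<kappa> by (simp add: divide_le_0_iff)
  have "- ((u x1 ^ 3 - u x1) / \<kappa>\<^sup>2) \<le> 0"
    by (rule second_derivative_at_max(2)[of "\<lambda>x. - u x" "\<lambda>x. - v x", OF DERIV_minus[OF u'] DERIV_minus[OF v'] x1])
  then have d1: "u x1 \<le> u x1 ^ 3" using \<kappa> by (simp add: zero_le_divide_iff)
  have ne: "u x0 ^ 3 \<noteq> u x0"
  proof
    assume "u x0 ^ 3 = u x0"
    then have "solves \<kappa> (\<lambda>_. u x0) (\<lambda>_. 0)" unfolding solves_def by simp
    then have "u = (\<lambda>_. u x0)"
      by (rule bounded_solution_unique[of \<kappa> u v _ _ "\<bar>u x0\<bar> + \<bar>u x1\<bar>" x0, OF sol])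
        (simp_all add: bd v0)
    then have "u x = u x0" for x by (rule fun_cong)
    then show False using nonconst unfolding constant_on_def by blast
  qed
  have pos: "0 < u x0 * ((1 - u x0) * (1 + u x0))"
    using order.not_eq_order_implies_strict[OF ne d0]
    by (simp add: algebra_simps power3_eq_cube)
  have neg: "u x1 * ((1 - u x1) * (1 + u x1)) \<le> 0"
    using d1 by (simp add: algebra_simps power3_eq_cube)
  have "\<not> u x0 < - 1"
  proof
    assume "u x0 < - 1"
    then have "u x1 < - 1" using x0[of x1] by simp
    then have "0 < u x1 * ((1 - u x1) * (1 + u x1))"
      by (intro mult_neg_neg mult_pos_neg) auto
    then show False using neg by simp
  qed
  then have "0 < u x0 \<and> u x0 < 1"
    using pos by (auto simp: zero_less_mult_iff mult_less_0_iff)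
  then show thesis using that[OF _ _ v0 bd] by simp
qed

section \<open>The amplitude--angle substitution\<close>

text \<open>For \<open>u = a * sin \<theta>\<close> the energy identity
  \<open>\<kappa>\<^sup>2 * u'\<^sup>2 = (a\<^sup>2 - u\<^sup>2) * (1 - (a\<^sup>2 + u\<^sup>2) / 2)\<close> loses the factor
  \<open>a\<^sup>2 * (cos \<theta>)\<^sup>2\<close> on both sides, and with it the singularity at the turning points.\<close>

definition angular_speed :: "real \<Rightarrow> real \<Rightarrow> real" where
  "angular_speed a \<theta> = sqrt (1 - a\<^sup>2 * (1 + (sin \<theta>)\<^sup>2) / 2)"

text \<open>The period is measured in the time \<open>x / \<kappa>\<close>. Up to a factor that depends on
  \<open>a\<close>, it is a complete elliptic integral of the first kind.\<close>

definition period :: "real \<Rightarrow> real" where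
  "period a = integral {0..2 * pi} (\<lambda>\<theta>. 1 / angular_speed a \<theta>)"

lemma angular_speed_radicand_pos:
  fixes a \<theta> :: real
  assumes "0 \<le> a" "a < 1"
  shows "0 < 1 - a\<^sup>2 * (1 + (sin \<theta>)\<^sup>2) / 2"
proof -
  have "a\<^sup>2 * (1 + (sin \<theta>)\<^sup>2) \<le> a\<^sup>2 * 2"
    by (intro mult_left_mono) (auto simp: abs_square_le_1)
  moreover have "a\<^sup>2 < 1" using assms by (simp add: abs_square_less_1)
  ultimately show ?thesis by simp
qed

lemma angular_speed_pos: "0 \<le> a \<Longrightarrow> a < 1 \<Longrightarrow> 0 < angular_speed a \<theta>"
  unfolding angular_speed_def using angular_speed_radicand_pos by simp

lemma angular_speed_le_1: "angular_speed a \<theta> \<le> 1"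
  unfolding angular_speed_def by simp

lemma angular_speed_square:
  "0 \<le> a \<Longrightarrow> a < 1 \<Longrightarrow> (angular_speed a \<theta>)\<^sup>2 = 1 - a\<^sup>2 * (1 + (sin \<theta>)\<^sup>2) / 2"
  unfolding angular_speed_def using angular_speed_radicand_pos[of a \<theta>] by simp

lemma continuous_on_inverse_speed:
  "continuous_on ({0..<1} \<times> UNIV) (\<lambda>(a, \<theta>). 1 / angular_speed a \<theta>)"
proof -
  have "angular_speed a \<theta> \<noteq> 0" if "(a, \<theta>) \<in> {0..<1} \<times> UNIV" for a \<theta>
    using angular_speed_pos[of a \<theta>] that by auto
  then show ?thesis
    unfolding angular_speed_def case_prod_unfold by (intro continuous_intros) auto
qed

lemma continuous_on_inverse_speed_angle:
  assumes "0 \<le> a" "a < 1"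
  shows "continuous_on S (\<lambda>\<theta>. 1 / angular_speed a \<theta>)"
proof -
  have "continuous_on S (Pair a)" by (intro continuous_intros)
  moreover have "Pair a ` S \<subseteq> {0..<1} \<times> UNIV" using assms by auto
  ultimately show ?thesis
    using continuous_on_compose2[OF continuous_on_inverse_speed, of S "Pair a"] by simp
qed

lemma two_pi_le_period:
  assumes "0 \<le> a" "a < 1"
  shows "2 * pi \<le> period a"
proof -
  have "integral {0..2 * pi} (\<lambda>_. 1) \<le> period a"
    unfolding period_def
    using angular_speed_pos[OF assms] angular_speed_le_1
    by (intro integral_le integrable_continuous_real continuous_on_inverse_speed_angle assms) auto
  then show ?thesis by simp
qed

lemma speed_derivative:
  assumes "0 \<le> a" "a < 1"
  shows "(angular_speed a has_real_derivative
    - (a\<^sup>2 * sin \<theta> * cos \<theta>) / (2 * angular_speed a \<theta>)) (at \<theta>)"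
  unfolding angular_speed_def
  using angular_speed_radicand_pos[OF assms, of \<theta>]
  by (auto intro!: derivative_eq_intros simp: field_simps)

text \<open>The equation for the angle is separable: time is the integral of the inverse speed over the
  angle, and the angle is the inverse function of time. Since the speed is \<open>2 * pi\<close>-periodic in
  the angle, every full turn takes the same time.\<close>

lemma angle_exists:
  assumes a: "0 \<le> a" "a < 1"
  obtains time angle :: "real \<Rightarrow> real"
  where "\<And>\<theta>. angle (time \<theta>) = \<theta>" "\<And>t. time (angle t) = t" "angle 0 = pi / 2"
    "\<And>t. (angle has_real_derivative angular_speed a (angle t)) (at t)"
    "\<And>\<theta> k. time (\<theta> + of_int k * (2 * pi)) = time \<theta> + of_int k * period a"
proof -
  let ?f = "\<lambda>\<theta>. 1 / angular_speed a \<theta>"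
  have "isCont ?f \<theta>" for \<theta>
    using continuous_on_inverse_speed_angle[OF a, of UNIV] by (simp add: continuous_on_eq_continuous_at)
  then obtain G where G: "\<And>\<theta>. (G has_real_derivative ?f \<theta>) (at \<theta>)"
    using einterval_antiderivative[of "-\<infinity>" "\<infinity>" ?f]
    by (auto simp: has_real_derivative_iff_has_vector_derivative)
  \<comment> \<open>time zero is put at the angle \<open>pi / 2\<close>, where \<open>a * sin \<theta>\<close> is maximal\<close>
  define F where "F \<theta> = G \<theta> - G (pi / 2)" for \<theta>
  have F: "(F has_real_derivative ?f \<theta>) (at \<theta>)" for \<theta>
    unfolding F_def by (auto intro!: derivative_eq_intros G)
  have F_cont: "isCont F \<theta>" for \<theta> using F by (rule DERIV_isCont)
  have f_pos: "1 \<le> ?f \<theta>" for \<theta>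
    using angular_speed_pos[OF a] angular_speed_le_1 by simp
  \<comment> \<open>the speed is at most 1, so time grows at least as fast as the angle; this gives injectivity and
    surjectivity at once\<close>
  have expand: "y - x \<le> F y - F x" if "x \<le> y" for x y
  proof -
    have "F x - x \<le> F y - y"
      using that
    proof (rule DERIV_nonneg_imp_nondecreasing)
      fix t
      have "((\<lambda>x. F x - x) has_real_derivative ?f t - 1) (at t)"
        by (auto intro!: derivative_eq_intros F)
      then show "\<exists>y. ((\<lambda>x. F x - x) has_real_derivative y) (at t) \<and> 0 \<le> y"
        using f_pos[of t] by force
    qed
    then show ?thesis by simp
  qed
  have inj: "inj F"
  proof (rule linorder_injI)
    fix x y :: real assume "x < y"
    then show "F x \<noteq> F y" using expand[of x y] by simp
  qed
  have surj: "\<exists>\<theta>. F \<theta> = t" for t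
  proof -
    have "F (pi / 2 - \<bar>t\<bar>) \<le> t"
      using expand[of "pi / 2 - \<bar>t\<bar>" "pi / 2"] by (simp add: F_def)
    moreover have "t \<le> F (pi / 2 + \<bar>t\<bar>)"
      using expand[of "pi / 2" "pi / 2 + \<bar>t\<bar>"] by (simp add: F_def)
    ultimately show ?thesis
      using IVT[of F "pi / 2 - \<bar>t\<bar>" t "pi / 2 + \<bar>t\<bar>"] F_cont by auto
  qed
  define angle where "angle = inv F"
  have left: "angle (F \<theta>) = \<theta>" for \<theta> unfolding angle_def using inj by simp
  have right: "F (angle t) = t" for t
    using surj[of t] left by metis
  have "isCont angle t" for t
    using isCont_inverse_function[of 1 "angle t" angle F] left F_cont right by simp
  then have deriv: "(angle has_real_derivative angular_speed a (angle t)) (at t)" for t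
    using DERIV_inverse_function[of F "?f (angle t)" angle t "t - 1" "t + 1"]
      F right angular_speed_pos[OF a, of "angle t"] by simp
  have "(?f has_integral F (2 * pi) - F 0) {0..2 * pi}"
    using F by (intro fundamental_theorem_of_calculus)
      (auto simp: has_real_derivative_iff_has_vector_derivative[symmetric]
        intro: has_field_derivative_at_within)
  then have period: "period a = F (2 * pi) - F 0"
    unfolding period_def by (rule integral_unique)
  have step: "F (\<theta> + 2 * pi) - F \<theta> = period a" for \<theta>
  proof -
    have "((\<lambda>\<theta>. F (\<theta> + 2 * pi) - F \<theta>) has_real_derivative 0) (at \<theta>)" for \<theta>
    proof -
      have "angular_speed a (\<theta> + 2 * pi) = angular_speed a \<theta>"
        unfolding angular_speed_def by simp
      then have "((\<lambda>\<theta>. F (\<theta> + 2 * pi)) has_real_derivative ?f \<theta>) (at \<theta>)"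
        using F[of "\<theta> + 2 * pi"] by (simp add: DERIV_shift)
      from DERIV_diff[OF this F] show ?thesis by simp
    qed
    then show ?thesis
      using DERIV_isconst_all[of "\<lambda>\<theta>. F (\<theta> + 2 * pi) - F \<theta>" \<theta> 0] period by simp
  qed
  have "F (\<theta> + of_int k * (2 * pi)) = F \<theta> + of_int k * period a" for \<theta> k
  proof -
    \<comment> \<open>time minus its linear drift is periodic\<close>
    define h where "h \<theta> = F \<theta> - period a * (\<theta> / (2 * pi))" for \<theta>
    have "h (\<theta> + 2 * pi) = h \<theta>" for \<theta>
      unfolding h_def using step[of \<theta>] by (simp add: add_divide_distrib distrib_left)
    from periodic_shift_int[of h, OF this, of \<theta> k] show ?thesis
      unfolding h_def by (simp add: add_divide_distrib distrib_left mult.commute)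
  qed
  note F_shift = this
  have start: "angle 0 = pi / 2" using left[of "pi / 2"] by (simp add: F_def)
  show thesis by (rule that[OF left right start deriv F_shift])
qed

text \<open>The solution is \<open>a * sin \<theta>\<close>, run at time \<open>x / \<kappa>\<close>. It equals \<open>a\<close> exactly
  when the angle is \<open>pi / 2\<close> modulo \<open>2 * pi\<close>, so the time between two maxima is a multiple of
  \<open>period a\<close>.\<close>

lemma profile_exists:
  assumes \<kappa>: "0 < \<kappa>" and a: "0 < a" "a < 1"
  obtains U V where "solves \<kappa> U V" "U 0 = a" "V 0 = 0" "\<And>x. \<bar>U x\<bar> \<le> a"
    "\<And>L. 0 < L \<Longrightarrow> (\<forall>x. U (x + L) = U x) \<longleftrightarrow> (\<exists>k::nat. 0 < k \<and> real k * period a = L / \<kappa>)"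
proof (rule angle_exists)
  show a': "0 \<le> a" and a1: "a < 1" using a by auto
  fix time angle :: "real \<Rightarrow> real"
  assume left: "\<And>\<theta>. angle (time \<theta>) = \<theta>" and right: "\<And>t. time (angle t) = t" and
    start: "angle 0 = pi / 2" and
    angle': "\<And>t. (angle has_real_derivative angular_speed a (angle t)) (at t)" and
    shift: "\<And>\<theta> k. time (\<theta> + of_int k * (2 * pi)) = time \<theta> + of_int k * period a"
  define U where "U x = a * sin (angle (x / \<kappa>))" for x
  define V where "V x = a * cos (angle (x / \<kappa>)) * angular_speed a (angle (x / \<kappa>)) / \<kappa>" for x
  have d: "((\<lambda>x. angle (x / \<kappa>)) has_real_derivative angular_speed a (angle (x / \<kappa>)) / \<kappa>) (at x)" for x
    by (rule DERIV_chain'[of "\<lambda>x. x / \<kappa>" "1 / \<kappa>", THEN DERIV_cong, OF _ angle'])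
      (use \<kappa> in \<open>auto intro!: derivative_eq_intros\<close>)
  have "(U has_real_derivative V x) (at x)" for x
    unfolding U_def V_def by (auto intro!: derivative_eq_intros d)
  moreover have "(V has_real_derivative (U x ^ 3 - U x) / \<kappa>\<^sup>2) (at x)" for x
  proof -
    define \<theta> where "\<theta> = angle (x / \<kappa>)"
    define g where "g = angular_speed a \<theta>"
    \<comment> \<open>differentiating the speed along the motion cancels the \<open>g\<close> in the denominator\<close>
    have g: "g \<noteq> 0" using angular_speed_pos[OF a' a(2), of \<theta>] unfolding g_def by simp
    have "((\<lambda>x. angular_speed a (angle (x / \<kappa>))) has_real_derivative
        - (a\<^sup>2 * sin \<theta> * cos \<theta>) / (2 * g) * (g / \<kappa>)) (at x)"
      unfolding \<theta>_def g_def by (rule DERIV_chain2[OF speed_derivative[OF a' a(2)] d])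
    then have gx: "((\<lambda>x. angular_speed a (angle (x / \<kappa>))) has_real_derivative
        - (a\<^sup>2 * sin \<theta> * cos \<theta>) / (2 * \<kappa>)) (at x)"
      using g by simp
    have "(V has_real_derivative
        (a * cos \<theta> * (- (a\<^sup>2 * sin \<theta> * cos \<theta>) / (2 * \<kappa>))
          + - (a * sin \<theta> * (g / \<kappa>)) * g) / \<kappa>) (at x)"
      unfolding V_def
      by (rule derivative_eq_intros d gx refl)+ (use \<kappa> in \<open>auto simp: \<theta>_def g_def field_simps\<close>)
    moreover have "(a * cos \<theta> * (- (a\<^sup>2 * sin \<theta> * cos \<theta>) / (2 * \<kappa>))
          + - (a * sin \<theta> * (g / \<kappa>)) * g) / \<kappa>
        = (- a * sin \<theta>) * (a\<^sup>2 * (cos \<theta>)\<^sup>2 / 2 + g\<^sup>2) / \<kappa>\<^sup>2"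
      using \<kappa> by (simp add: field_simps power2_eq_square)
    also have "a\<^sup>2 * (cos \<theta>)\<^sup>2 / 2 + g\<^sup>2 = 1 - (U x)\<^sup>2"
      unfolding g_def angular_speed_square[OF a' a(2)] U_def \<theta>_def[symmetric]
      by (simp add: cos_squared_eq algebra_simps add_divide_distrib diff_divide_distrib)
    also have "(- a * sin \<theta>) * (1 - (U x)\<^sup>2) = U x ^ 3 - U x"
      unfolding U_def \<theta>_def[symmetric] by (simp add: algebra_simps power2_eq_square power3_eq_cube)
    ultimately show ?thesis by (simp only:)
  qed
  ultimately have "solves \<kappa> U V" unfolding solves_def by blast
  moreover have "U 0 = a" "V 0 = 0" unfolding U_def V_def by (simp_all add: start)
  moreover have "\<bar>U x\<bar> \<le> a" for x
    unfolding U_def using a by (simp add: abs_mult mult_left_le)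
  moreover have "(\<forall>x. U (x + L) = U x) \<longleftrightarrow> (\<exists>k::nat. 0 < k \<and> real k * period a = L / \<kappa>)"
    if L: "0 < L" for L
  proof
    assume per: "\<forall>x. U (x + L) = U x"
    then have "U L = a" using \<open>U 0 = a\<close> by (metis add_0)
    then have "sin (angle (L / \<kappa>)) = 1" unfolding U_def using a by simp
    then obtain k :: int where "angle (L / \<kappa>) = pi / 2 + of_int k * (2 * pi)"
      unfolding sin_eq_1 by (auto simp: algebra_simps)
    then have k: "L / \<kappa> = of_int k * period a"
      using right[of "L / \<kappa>"] right[of 0] by (simp add: start shift)
    have "0 < period a" using two_pi_le_period[OF a' a(2)] pi_gt_zero by linarith
    then have "0 < k" using k L \<kappa> by (metis divide_pos_pos of_int_0_less_iff zero_less_mult_pos2)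
    then show "\<exists>k::nat. 0 < k \<and> real k * period a = L / \<kappa>"
      using k by (intro exI[of _ "nat k"]) auto
  next
    assume "\<exists>k::nat. 0 < k \<and> real k * period a = L / \<kappa>"
    then obtain k :: nat where k: "real k * period a = L / \<kappa>" by blast
    show "\<forall>x. U (x + L) = U x"
    proof
      fix x
      have "(x + L) / \<kappa> = time (angle (x / \<kappa>) + of_int (int k) * (2 * pi))"
        unfolding shift by (simp add: right k add_divide_distrib)
      then have "angle ((x + L) / \<kappa>) = angle (x / \<kappa>) + of_int (int k) * (2 * pi)"
        by (simp only: left)
      then show "U (x + L) = U x"
        unfolding U_def using sin.plus_of_nat[of "angle (x / \<kappa>)" k] by simp
    qed
  qed
  ultimately show thesis by (rule that)
qed

section \<open>The period as a function of the amplitude\<close>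

lemma period_0: "period 0 = 2 * pi"
  unfolding period_def angular_speed_def by simp

lemma continuous_on_period: "continuous_on {0..<1} period"
proof -
  have "continuous_on ({0..<1} \<times> cbox 0 (2 * pi)) (\<lambda>(a, \<theta>). 1 / angular_speed a \<theta>)"
    by (rule continuous_on_subset[OF continuous_on_inverse_speed]) auto
  then show ?thesis
    unfolding period_def[abs_def] cbox_interval[symmetric] by (rule integral_continuous_on_param)
qed

lemma period_strict_mono:
  assumes "0 \<le> a" "a < b" "b < 1"
  shows "period a < period b"
  unfolding period_def
proof (rule integral_less_real)
  have a: "0 \<le> a" "a < 1" and b: "0 \<le> b" "b < 1" using assms by auto
  show "continuous_on {0..2 * pi} (\<lambda>\<theta>. 1 / angular_speed a \<theta>)"
    "continuous_on {0..2 * pi} (\<lambda>\<theta>. 1 / angular_speed b \<theta>)"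
    by (intro continuous_on_inverse_speed_angle a b)+
  show "{0<..<2 * pi} \<noteq> {}" by (simp add: not_le)
  show "1 / angular_speed a \<theta> < 1 / angular_speed b \<theta>" for \<theta>
  proof -
    have "a\<^sup>2 * (1 + (sin \<theta>)\<^sup>2) < b\<^sup>2 * (1 + (sin \<theta>)\<^sup>2)"
      using assms by (intro mult_strict_right_mono power_strict_mono add_pos_nonneg) auto
    then have "angular_speed b \<theta> < angular_speed a \<theta>"
      unfolding angular_speed_def by simp
    then show ?thesis
      using angular_speed_pos[OF b] by (simp add: frac_less2)
  qed
qed

text \<open>As \<open>a\<close> tends to 1, the solution lingers near the equilibrium 1: between the angles 0 and
  \<open>pi / 2\<close> the speed is at most \<open>\<epsilon> + (pi / 2 - \<theta>)\<close> with \<open>\<epsilon> = sqrt (1 - a\<^sup>2)\<close>, and the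
  integral of the inverse of this bound is at least \<open>- ln \<epsilon>\<close>.\<close>

lemma period_unbounded:
  obtains a where "0 \<le> a" "a < 1" "K \<le> period a"
proof -
  \<comment> \<open>chosen so that \<open>- ln \<epsilon>\<close> exceeds \<open>K\<close>\<close>
  define \<epsilon> where "\<epsilon> = exp (- \<bar>K\<bar> - 1)"
  define a where "a = sqrt (1 - \<epsilon>\<^sup>2)"
  have \<epsilon>: "0 < \<epsilon>" "\<epsilon> < 1" unfolding \<epsilon>_def by auto
  then have "0 < \<epsilon>\<^sup>2" "\<epsilon>\<^sup>2 < 1" by (auto simp: abs_square_less_1)
  then have a: "0 \<le> a" "a < 1" and a2: "a\<^sup>2 = 1 - \<epsilon>\<^sup>2"
    unfolding a_def by auto
  let ?f = "\<lambda>\<theta>. 1 / angular_speed a \<theta>"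
  let ?g = "\<lambda>\<theta>. 1 / (\<epsilon> + (pi / 2 - \<theta>))"
  have g: "(?g has_integral - ln (\<epsilon> + (pi / 2 - pi / 2)) - - ln (\<epsilon> + (pi / 2 - 0))) {0..pi / 2}"
  proof (rule fundamental_theorem_of_calculus)
    fix \<theta> assume "\<theta> \<in> {0..pi / 2}"
    then have "0 < \<epsilon> + (pi / 2 - \<theta>)" using \<epsilon> by simp
    then have "((\<lambda>\<theta>. - ln (\<epsilon> + (pi / 2 - \<theta>))) has_real_derivative ?g \<theta>) (at \<theta> within {0..pi / 2})"
      by (auto intro!: derivative_eq_intros)
    then show "((\<lambda>\<theta>. - ln (\<epsilon> + (pi / 2 - \<theta>))) has_vector_derivative ?g \<theta>) (at \<theta> within {0..pi / 2})"
      by (simp add: has_real_derivative_iff_has_vector_derivative)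
  qed simp
  have "0 \<le> ln (\<epsilon> + pi / 2)" using \<epsilon> pi_ge_two by (intro ln_ge_zero) linarith
  then have "K \<le> integral {0..pi / 2} ?g"
    unfolding integral_unique[OF g] by (simp add: \<epsilon>_def)
  also have "\<dots> \<le> integral {0..pi / 2} ?f"
  proof (rule integral_le)
    show "?g integrable_on {0..pi / 2}" using g by blast
    show "?f integrable_on {0..pi / 2}"
      by (intro integrable_continuous_real continuous_on_inverse_speed_angle a)
    fix \<theta> assume \<theta>: "\<theta> \<in> {0..pi / 2}"
    \<comment> \<open>the angular distance from the maximum of \<open>u\<close>\<close>
    define \<psi> where "\<psi> = pi / 2 - \<theta>"
    have \<psi>: "0 \<le> \<psi>" "\<bar>sin \<psi>\<bar> \<le> \<psi>" "cos \<theta> = sin \<psi>"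
      using \<theta> abs_sin_x_le_abs_x[of \<psi>] unfolding \<psi>_def by (auto simp: sin_diff)
    have "a\<^sup>2 * (cos \<theta>)\<^sup>2 \<le> 1 * \<psi>\<^sup>2"
    proof (rule mult_mono)
      show "(cos \<theta>)\<^sup>2 \<le> \<psi>\<^sup>2" unfolding \<psi>(3) using \<psi> by (simp add: abs_le_square_iff[symmetric])
    qed (use a2 in auto)
    moreover have "(angular_speed a \<theta>)\<^sup>2 = \<epsilon>\<^sup>2 + a\<^sup>2 * (cos \<theta>)\<^sup>2 / 2"
      unfolding angular_speed_square[OF a] a2 by (simp add: cos_squared_eq field_simps)
    moreover have "(\<epsilon> + \<psi>)\<^sup>2 = \<epsilon>\<^sup>2 + 2 * (\<epsilon> * \<psi>) + \<psi>\<^sup>2" by (simp add: power2_sum)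
    moreover have "0 \<le> \<epsilon> * \<psi>" using \<epsilon> \<psi> by simp
    ultimately have "(angular_speed a \<theta>)\<^sup>2 \<le> (\<epsilon> + \<psi>)\<^sup>2"
      using zero_le_power2[of \<psi>] by linarith
    moreover have "0 \<le> \<epsilon> + \<psi>" using \<epsilon> \<psi> by simp
    ultimately have "angular_speed a \<theta> \<le> \<epsilon> + \<psi>" by (rule power2_le_imp_le)
    then have "1 / (\<epsilon> + \<psi>) \<le> ?f \<theta>"
      using angular_speed_pos[OF a, of \<theta>] by (intro frac_le) simp_all
    then show "?g \<theta> \<le> ?f \<theta>" unfolding \<psi>_def .
  qed
  also have "\<dots> \<le> period a"
    unfolding period_def
    using angular_speed_pos[OF a]
    by (intro integral_subset_le integrable_continuous_real continuous_on_inverse_speed_angle a)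
      (auto intro: less_imp_le)
  finally show thesis using that a by blast
qed

text \<open>At \<open>a = 0\<close> the angle turns with constant speed 1, which corresponds to the equation
  linearised at 0; so \<open>2 * pi\<close> is where the intermediate value theorem starts.\<close>

lemma amplitude_exists:
  assumes "2 * pi < P"
  obtains a where "0 < a" "a < 1" "period a = P"
proof -
  obtain b where b: "0 \<le> b" "b < 1" "P \<le> period b" by (rule period_unbounded)
  have "continuous_on {0..b} period"
    using b by (intro continuous_on_subset[OF continuous_on_period]) auto
  then obtain a where a: "0 \<le> a" "a \<le> b" "period a = P"
    using IVT'[of period 0 P b] b assms by (auto simp: period_0)
  moreover have "a \<noteq> 0" using a assms by (auto simp: period_0)
  ultimately show thesis using that[of a] b by simp
qed

section \<open>Counting the classes\<close>

text \<open>The identifications are reparametrisations of the line, so the set of values, and with it the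
  amplitude, is an invariant of the class.\<close>

lemma obtained_from_range:
  assumes "obtained_from u v"
  shows "range v = range u"
  using assms
proof induction
  case (translate v a)
  have "range (\<lambda>x. v (x + a)) = v ` range (\<lambda>x. x + a)" by (simp only: image_image)
  also have "range (\<lambda>x::real. x + a) = UNIV" by (rule surjI[of _ "\<lambda>x. x - a"]) simp
  finally show ?case using translate.IH by simp
next
  case (reflect v)
  have "range (\<lambda>x. v (- x)) = v ` range (\<lambda>x. - x)" by (simp only: image_image)
  also have "range (\<lambda>x::real. - x) = UNIV" by (rule surjI[of _ uminus]) simp
  finally show ?case using reflect.IH by simp
qed simp

lemma nonconstant_if_not_equilibrium:
  assumes "solves \<kappa> u v" "0 < \<kappa>" "0 < u x" "u x < 1"
  shows "\<not> u constant_on UNIV"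
proof
  assume "u constant_on UNIV"
  then obtain c where c: "u = (\<lambda>_. c)" unfolding constant_on_def by auto
  have u': "(u has_real_derivative v t) (at t)"
    and v': "(v has_real_derivative (u t ^ 3 - u t) / \<kappa>\<^sup>2) (at t)" for t
    using assms(1) unfolding solves_def by auto
  have "v = (\<lambda>_. 0)"
  proof
    fix t
    have "(u has_real_derivative 0) (at t)" unfolding c by simp
    then show "v t = 0" using u' by (rule DERIV_unique[rotated])
  qed
  then have "(v has_real_derivative 0) (at x)" by simp
  then have "(u x ^ 3 - u x) / \<kappa>\<^sup>2 = 0" using v' by (rule DERIV_unique[rotated])
  then have "u x * u x ^ 2 = u x" using assms(2) by (simp add: power3_eq_cube power2_eq_square)
  then have "(u x)\<^sup>2 = 1" using assms(3) by simp
  then show False using assms(3,4) by (simp add: power2_eq_1_iff)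
qed

theorem theorem1p1:
  fixes \<kappa> :: real
  assumes "0 < \<kappa>" and "\<kappa> < 1"
  shows "finite (nonconstant_periodic_solutions \<kappa> // identified \<kappa>) \<and>
         card (nonconstant_periodic_solutions \<kappa> // identified \<kappa>) = m_kappa \<kappa>"
proof -
  let ?S = "nonconstant_periodic_solutions \<kappa>" and ?R = "identified \<kappa>"
  let ?L = "2 * pi"
  let ?profile = "\<lambda>a U V. solves \<kappa> U V \<and> U 0 = a \<and> V 0 = 0 \<and> (\<forall>x. \<bar>U x\<bar> \<le> a) \<and>
      ((\<forall>x. U (x + ?L) = U x) \<longleftrightarrow> (\<exists>k::nat. 0 < k \<and> real k * period a = ?L / \<kappa>))"
  have L: "0 < ?L" by simp
  have "\<forall>a\<in>{0<..<1}. \<exists>p. ?profile a (fst p) (snd p)"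
  proof
    fix a :: real assume "a \<in> {0<..<1}"
    then have a: "0 < a" "a < 1" by auto
    show "\<exists>p. ?profile a (fst p) (snd p)"
    proof (rule profile_exists[OF assms(1) a])
      fix U V
      assume "solves \<kappa> U V" "U 0 = a" "V 0 = 0" "\<And>x. \<bar>U x\<bar> \<le> a"
        and "\<And>L. 0 < L \<Longrightarrow>
          (\<forall>x. U (x + L) = U x) \<longleftrightarrow> (\<exists>k::nat. 0 < k \<and> real k * period a = L / \<kappa>)"
      note facts = this(1-4) this(5)[OF L]
      show ?thesis by (intro exI[of _ "(U, V)"]) (simp only: facts fst_conv snd_conv simp_thms)
    qed
  qed
  then obtain p where "\<forall>a\<in>{0<..<1}. ?profile a (fst (p a)) (snd (p a))" by (rule bchoice[THEN exE])
  moreover define U V where "U a = fst (p a)" and "V a = snd (p a)" for a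
  ultimately have profile: "?profile a (U a) (V a)" if "0 < a" "a < 1" for a
    using that by simp
  have UV: "solves \<kappa> (U a) (V a)" and U0: "U a 0 = a" and V0: "V a 0 = 0"
    and bd: "\<bar>U a x\<bar> \<le> a"
    and per: "(\<forall>x. U a (x + ?L) = U a x) \<longleftrightarrow> (\<exists>k::nat. 0 < k \<and> real k * period a = ?L / \<kappa>)"
    if "0 < a" "a < 1" for a x
    using profile[OF that] by blast+
  have "\<exists>a. 0 < a \<and> a < 1 \<and> real k * period a = ?L / \<kappa>" if k: "k \<in> {1..m_kappa \<kappa>}" for k
  proof -
    have "real k * \<kappa> \<le> real (m_kappa \<kappa>) * \<kappa>" using k assms by (intro mult_right_mono) auto
    then have "real k * \<kappa> < 1" using m_kappa_largest(2)[OF assms] by simp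
    then have "?L < ?L / (real k * \<kappa>)" using k assms by (simp add: field_simps)
    then obtain a where "0 < a" "a < 1" "period a = ?L / (real k * \<kappa>)"
      by (rule amplitude_exists)
    then show ?thesis using k assms by (intro exI[of _ a]) (auto simp: field_simps)
  qed
  then obtain amp where amp: "\<And>k. k \<in> {1..m_kappa \<kappa>} \<Longrightarrow>
      0 < amp k \<and> amp k < 1 \<and> real k * period (amp k) = ?L / \<kappa>"
    by metis
  \<comment> \<open>the class numbered \<open>k\<close> makes \<open>k\<close> full turns within \<open>2 * pi\<close>\<close>
  define F where "F k = ?R `` {U (amp k)}" for k
  have in_S: "U (amp k) \<in> ?S" if k: "k \<in> {1..m_kappa \<kappa>}" for k
  proof -
    have a: "0 < amp k" "amp k < 1" "real k * period (amp k) = ?L / \<kappa>" using amp[OF k] by auto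
    have "0 < k" using k by simp
    then have "\<forall>x. U (amp k) (x + ?L) = U (amp k) x" using per[OF a(1,2)] a(3) by blast
    moreover have "\<not> U (amp k) constant_on UNIV"
      using nonconstant_if_not_equilibrium[OF UV[OF a(1,2)] assms(1), of 0] U0 a by simp
    ultimately show ?thesis
      unfolding nonconstant_periodic_solutions_def
      using classical_solution_iff[OF assms(1)] UV[OF a(1,2)] by blast
  qed
  have "inj_on F {1..m_kappa \<kappa>}"
  proof (rule inj_onI)
    fix j k assume j: "j \<in> {1..m_kappa \<kappa>}" and k: "k \<in> {1..m_kappa \<kappa>}" and "F j = F k"
    then have "(U (amp j), U (amp k)) \<in> ?R"
      unfolding F_def using eq_equiv_class_iff[OF equiv_identified in_S[OF j] in_S[OF k]] by simp
    then have range: "range (U (amp k)) = range (U (amp j))"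
      unfolding identified_def using obtained_from_range by auto
    have aj: "0 < amp j" "amp j < 1" and ak: "0 < amp k" "amp k < 1"
      using amp[OF j] amp[OF k] by auto
    have "amp j \<in> range (U (amp k))" using range U0[OF aj] by (metis rangeI)
    then have "amp j \<le> amp k" using bd[OF ak] by (force simp: abs_le_iff)
    moreover have "amp k \<in> range (U (amp j))" using range U0[OF ak] by (metis rangeI)
    then have "amp k \<le> amp j" using bd[OF aj] by (force simp: abs_le_iff)
    ultimately have "amp j = amp k" by simp
    then have "real j * period (amp k) = real k * period (amp k)"
      using amp[OF j] amp[OF k] by simp
    moreover have "0 < period (amp k)"
      using two_pi_le_period[of "amp k"] ak pi_gt_zero by linarith
    ultimately show "j = k" by simp
  qed
  moreover have "F ` {1..m_kappa \<kappa>} = ?S // ?R"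
  proof
    show "F ` {1..m_kappa \<kappa>} \<subseteq> ?S // ?R"
      unfolding F_def using in_S by (auto intro: quotientI)
    show "?S // ?R \<subseteq> F ` {1..m_kappa \<kappa>}"
    proof
      fix X assume "X \<in> ?S // ?R"
      then obtain u where u: "u \<in> ?S" and X: "X = ?R `` {u}" by (rule quotientE)
      then obtain v where uv: "solves \<kappa> u v"
        unfolding nonconstant_periodic_solutions_def using classical_solution_iff[OF assms(1)] by blast
      have u_per: "u (x + ?L) = u x" and u_nc: "\<not> u constant_on UNIV" for x
        using u unfolding nonconstant_periodic_solutions_def by auto
      obtain x0 B where x0: "0 < u x0" "u x0 < 1" "v x0 = 0" and B: "\<And>x. \<bar>u x\<bar> \<le> B"
        by (rule nonconstant_periodic_solution_max[OF uv assms(1) u_per L u_nc]) blast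
      define a where "a = u x0"
      have a: "0 < a" "a < 1" using x0 unfolding a_def by auto
      \<comment> \<open>both solutions start at rest from \<open>a\<close>\<close>
      have eq: "(\<lambda>x. u (x + x0)) = U a"
      proof (rule bounded_solution_unique[OF solves_shift[OF uv] UV[OF a]])
        show "\<bar>u (x + x0)\<bar> \<le> max B a" "\<bar>U a x\<bar> \<le> max B a" for x
          using B[of "x + x0"] bd[OF a, of x] by auto
        show "u (0 + x0) = U a 0" "v (0 + x0) = V a 0"
          using U0[OF a] V0[OF a] x0 unfolding a_def by auto
      qed
      have "U a (x + ?L) = U a x" for x
        unfolding eq[symmetric] using u_per[of "x + x0"] by (simp add: add_ac)
      then obtain k :: nat where k: "0 < k" "real k * period a = ?L / \<kappa>"
        using per[OF a] by blast
      have "real k * period 0 < ?L / \<kappa>"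
        using period_strict_mono[of 0 a] a k by (simp flip: k(2))
      then have "real k * \<kappa> < 1" using assms by (simp add: period_0 field_simps)
      then have k_in: "k \<in> {1..m_kappa \<kappa>}" using m_kappa_largest(3)[OF assms] k by auto
      have "real k * period (amp k) = real k * period a" using amp[OF k_in] k by simp
      then have "period (amp k) = period a"
        unfolding mult_cancel_left using k(1) by simp
      then have "amp k = a"
        using period_strict_mono[of a "amp k"] period_strict_mono[of "amp k" a] amp[OF k_in] a
        by (cases a "amp k" rule: linorder_cases) auto
      then have "obtained_from u (U (amp k))"
        unfolding eq[symmetric] using obtained_from.translate[OF obtained_from.same, of u x0] eq by simp
      then have "(u, U (amp k)) \<in> ?R"
        unfolding identified_def using u in_S[OF k_in] by simp
      then have "X = F k"
        unfolding X F_def by (rule equiv_class_eq[OF equiv_identified])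
      then show "X \<in> F ` {1..m_kappa \<kappa>}" using k_in by blast
    qed
  qed
  ultimately have bij: "bij_betw F {1..m_kappa \<kappa>} (?S // ?R)"
    unfolding bij_betw_def by blast
  then show ?thesis
    using bij_betw_finite[OF bij] bij_betw_same_card[OF bij] by simp
qed

end
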